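(* Let $\sigma=1-\alpha/2$, let $\tau=T/M$ with $T>0$ and $M\ge 1$ an integer, let $t_s=s\tau$ for real $s\ge 0$, and let $j\in\{0,1,\dots,M-1\}$. For any $\alpha\in(0,1)$ and $v(t)\in\mathcal{C}^3[0,t_{j+1}]$, it is true that $$\partial_{0t_{j+\sigma}}^{\alpha,\lambda(t)}v=\Delta_{0t_{j+\sigma}}^{\alpha,\lambda(t)}v+\mathcal{O}(\tau^2),$$ where $\lambda(t)>0$, $\lambda'(t)\le 0$ and $\lambda(t)\in\mathcal{C}^2[0,t_{j+1}]$.
   Context: The generalized Caputo fractional derivative of order $\alpha$ with weighting function $\lambda$ at the point $t_{j+\sigma}=(j+\sigma)\tau$ of the uniform time grid is $$\partial_{0t_{j+\sigma}}^{\alpha,\lambda(t)}v=\frac{1}{\Gamma(1-\alpha)}\int_0^{t_{j+\sigma}}\frac{\lambda(t_{j+\sigma}-\eta)}{(t_{j+\sigma}-\eta)^\alpha}v'(\eta)\,d\eta .$$ Its discrete analog (the $_\lambda$L2-1$_\sigma$ formula) is $$\Delta_{0t_{j+\sigma}}^{\alpha,\lambda(t)}v=\frac{\tau^{1-\alpha}}{\Gamma(2-\alpha)}\sum_{s=0}^{j}c_{j-s}^{(\alpha)}\,v_{t,s},\qquad v_{t,s}=\frac{v(t_{s+1})-v(t_s)}{\tau}.$$ The coefficients are as follows. Write $\lambda_s=\lambda(t_s)=\lambda(s\tau)$ for real $s$, $$a_0^{(\alpha)}=\sigma^{1-\alpha},\qquad a_l^{(\alpha)}=(l+\sigma)^{1-\alpha}-(l-1+\sigma)^{1-\alpha}\quad(l\ge1),$$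 $$b_l^{(\alpha)}=\tfrac{1}{2-\alpha}\left[(l+\sigma)^{2-\alpha}-(l-1+\sigma)^{2-\alpha}\right]-\tfrac12\left[(l+\sigma)^{1-\alpha}+(l-1+\sigma)^{1-\alpha}\right]\quad(l\ge1).$$ For $j=0$: $c_0^{(\alpha)}=\lambda_{\sigma-1/2}a_0^{(\alpha)}$. For $j\ge1$: $$c_s^{(\alpha)}=\begin{cases}\lambda_{\sigma-1/2}a_0^{(\alpha)}+\lambda_\sigma b_1^{(\alpha)}, & s=0,\\ \lambda_{s+\sigma-1/2}a_s^{(\alpha)}+\lambda_{s+\sigma}b_{s+1}^{(\alpha)}-\lambda_{s+\sigma}b_s^{(\alpha)}, & 1\le s\le j-1,\\ \lambda_{j+\sigma-1/2}a_j^{(\alpha)}-\lambda_{j+\sigma}b_j^{(\alpha)}, & s=j.\end{cases}$$ *)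

theory Defs
  imports "HOL-Analysis.Analysis"
begin

text \<open>
  Derivatives on a closed interval \<open>S\<close> are taken within \<open>S\<close>, hence one-sided at the endpoints.
\<close>

definition deriv_on :: "real set \<Rightarrow> (real \<Rightarrow> real) \<Rightarrow> real \<Rightarrow> real" where
  "deriv_on S f x = vector_derivative f (at x within S)"

definition nderiv_on :: "nat \<Rightarrow> real set \<Rightarrow> (real \<Rightarrow> real) \<Rightarrow> real \<Rightarrow> real" where
  "nderiv_on n S f = (deriv_on S ^^ n) f"

definition C_k_on :: "nat \<Rightarrow> real set \<Rightarrow> (real \<Rightarrow> real) \<Rightarrow> bool" where
  "C_k_on k S f \<longleftrightarrow>
     (\<forall>i<k. nderiv_on i S f differentiable_on S) \<and> continuous_on S (nderiv_on k S f)"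

text \<open>
  Generalized Caputo derivative of order \<open>\<alpha>\<close> with weight \<open>lam\<close> at the point \<open>t\<close>.  For \<open>v\<close>
  differentiable on \<open>{0..t}\<close> only, the two-sided \<open>deriv v\<close> may be unspecified at the endpoints,
  which does not affect the integral.
\<close>

definition caputo_deriv :: "real \<Rightarrow> (real \<Rightarrow> real) \<Rightarrow> real \<Rightarrow> (real \<Rightarrow> real) \<Rightarrow> real" where
  "caputo_deriv \<alpha> lam t v =
     1 / Gamma (1 - \<alpha>) *
     integral {0..t} (\<lambda>\<eta>. lam (t - \<eta>) / (t - \<eta>) powr \<alpha> * deriv v \<eta>)"

definition coeff_a :: "real \<Rightarrow> real \<Rightarrow> nat \<Rightarrow> real" where
  "coeff_a \<alpha> \<sigma> l =
     (if l = 0 then \<sigma> powr (1 - \<alpha>)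
      else (real l + \<sigma>) powr (1 - \<alpha>) - (real l - 1 + \<sigma>) powr (1 - \<alpha>))"

text \<open>Only used for \<open>l \<ge> 1\<close>.\<close>

definition coeff_b :: "real \<Rightarrow> real \<Rightarrow> nat \<Rightarrow> real" where
  "coeff_b \<alpha> \<sigma> l =
     1 / (2 - \<alpha>) * ((real l + \<sigma>) powr (2 - \<alpha>) - (real l - 1 + \<sigma>) powr (2 - \<alpha>))
     - 1 / 2 * ((real l + \<sigma>) powr (1 - \<alpha>) + (real l - 1 + \<sigma>) powr (1 - \<alpha>))"

text \<open>Only used for \<open>s \<le> j\<close>, so the last branch is the case \<open>s = j\<close>.\<close>

definition coeff_c ::
    "real \<Rightarrow> real \<Rightarrow> real \<Rightarrow> (real \<Rightarrow> real) \<Rightarrow> nat \<Rightarrow> nat \<Rightarrow> real" where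
  "coeff_c \<alpha> \<sigma> \<tau> lam j s =
     (let L = (\<lambda>r. lam (r * \<tau>)); a = coeff_a \<alpha> \<sigma>; b = coeff_b \<alpha> \<sigma> in
      if j = 0 then L (\<sigma> - 1/2) * a 0
      else if s = 0 then L (\<sigma> - 1/2) * a 0 + L \<sigma> * b 1
      else if s < j then
        L (real s + \<sigma> - 1/2) * a s + L (real s + \<sigma>) * b (s + 1) - L (real s + \<sigma>) * b s
      else L (real j + \<sigma> - 1/2) * a j - L (real j + \<sigma>) * b j)"

definition fwd_diff :: "real \<Rightarrow> (real \<Rightarrow> real) \<Rightarrow> nat \<Rightarrow> real" where
  "fwd_diff \<tau> v s = (v (real (s + 1) * \<tau>) - v (real s * \<tau>)) / \<tau>"

text \<open>The \<open>\<lambda>\<close>L2-1\<open>\<sigma>\<close> formula at the point \<open>(j + \<sigma>) \<tau>\<close>.\<close>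

definition discrete_caputo ::
    "real \<Rightarrow> real \<Rightarrow> real \<Rightarrow> (real \<Rightarrow> real) \<Rightarrow> nat \<Rightarrow> (real \<Rightarrow> real) \<Rightarrow> real" where
  "discrete_caputo \<alpha> \<sigma> \<tau> lam j v =
     \<tau> powr (1 - \<alpha>) / Gamma (2 - \<alpha>) *
     (\<Sum>s=0..j. coeff_c \<alpha> \<sigma> \<tau> lam j (j - s) * fwd_diff \<tau> v s)"

end

theory Submission
  imports Defs
begin

text \<open>
  On each cell of the grid the product \<open>F \<eta> = \<lambda>(t - \<eta>) v'(\<eta>)\<close> with \<open>t = t\<^sub>j\<^sub>+\<^sub>\<sigma>\<close> is replaced by an affine
  function around the midpoint.  Integrating this function exactly against \<open>(t - \<eta>)\<^sup>-\<^sup>\<alpha>\<close> produces the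
  coefficients \<open>a\<close> (value at the midpoint) and \<open>b\<close> (slope), and after summation by parts the discrete
  operator.  On the full cells the slope
  \<open>(\<lambda>\<^sub>l\<^sub>-\<^sub>1\<^sub>+\<^sub>\<sigma> v\<^sub>t\<^sub>,\<^sub>s - \<lambda>\<^sub>l\<^sub>+\<^sub>\<sigma> v\<^sub>t\<^sub>,\<^sub>s\<^sub>-\<^sub>1) / \<tau>\<close> approximates \<open>F'\<close> to first order, which suffices because
  it is multiplied by a distance of order \<open>\<tau>\<close>.  Hence the pointwise error is \<open>O(\<tau>\<^sup>2)\<close>, and integrability
  of the kernel gives the global bound.
\<close>

section \<open>Taylor and product estimates\<close>

text \<open>Second-order Taylor polynomials at \<open>x\<close> towards both neighbours: adding them
  cancels the odd terms, subtracting them the even ones. The Taylor remainder is divided only by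
  \<open>fact 2\<close>, so each direction costs \<open>B * h ^ 3 / 2\<close>.\<close>

lemma central_difference_bounds:
  fixes f f1 f2 f3 :: "real \<Rightarrow> real"
  assumes f: "\<And>x. x \<in> S \<Longrightarrow> (f has_real_derivative f1 x) (at x within S)"
    and f1: "\<And>x. x \<in> S \<Longrightarrow> (f1 has_real_derivative f2 x) (at x within S)"
    and f2: "\<And>x. x \<in> S \<Longrightarrow> (f2 has_real_derivative f3 x) (at x within S)"
    and B: "\<And>x. x \<in> S \<Longrightarrow> \<bar>f3 x\<bar> \<le> B"
    and S: "convex S" "x - h \<in> S" "x \<in> S" "x + h \<in> S" and h: "h \<ge> 0"
  shows "\<bar>f (x + h) - 2 * f x + f (x - h) - f2 x * h\<^sup>2\<bar> \<le> B * h ^ 3"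
    and "\<bar>f (x + h) - f (x - h) - 2 * (f1 x * h)\<bar> \<le> B * h ^ 3"
proof -
  define g where "g i = [f, f1, f2, f3] ! i" for i
  have g: "g 0 = f" "g (Suc 0) = f1" "g 2 = f2" "g 3 = f3"
    by (auto simp: g_def numeral_eq_Suc)
  have "(g i has_real_derivative g (Suc i) y) (at y within S)" if "y \<in> S" "i \<le> 2" for y i
    using f[OF that(1)] f1[OF that(1)] f2[OF that(1)] that(2)
    by (auto simp: g_def numeral_eq_Suc le_Suc_eq)
  moreover have "norm (g (Suc 2) y) \<le> B" if "y \<in> S" for y
    using B[OF that] g(4) by simp
  ultimately have taylor: "norm (g 0 z - (\<Sum>i\<le>2. g i x * (z - x) ^ i / fact i))
      \<le> B * norm (z - x) ^ Suc 2 / fact 2" if "z \<in> S" for z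
    using field_Taylor[of S 2 g B x z] S that by blast
  have 1: "\<bar>f (x + h) - (f x + f1 x * h + f2 x * h\<^sup>2 / 2)\<bar> \<le> B * h ^ 3 / 2"
    using taylor[OF S(4)] h
    by (simp add: g numeral_2_eq_2 numeral_3_eq_3 flip: g(3))
  have 2: "\<bar>f (x - h) - (f x - f1 x * h + f2 x * h\<^sup>2 / 2)\<bar> \<le> B * h ^ 3 / 2"
    using taylor[OF S(2)] h
    by (simp add: g numeral_2_eq_2 numeral_3_eq_3 flip: g(3))
  show "\<bar>f (x + h) - 2 * f x + f (x - h) - f2 x * h\<^sup>2\<bar> \<le> B * h ^ 3"
    using 1 2 by linarith
  show "\<bar>f (x + h) - f (x - h) - 2 * (f1 x * h)\<bar> \<le> B * h ^ 3"
    using 1 2 by linarith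
qed

lemma first_order_Taylor_bound:
  fixes f f1 f2 :: "real \<Rightarrow> real"
  assumes f: "\<And>x. x \<in> S \<Longrightarrow> (f has_real_derivative f1 x) (at x within S)"
    and f1: "\<And>x. x \<in> S \<Longrightarrow> (f1 has_real_derivative f2 x) (at x within S)"
    and B: "\<And>x. x \<in> S \<Longrightarrow> \<bar>f2 x\<bar> \<le> B"
    and S: "convex S" "x \<in> S" "y \<in> S"
  shows "\<bar>f y - f x - f1 x * (y - x)\<bar> \<le> B * (y - x)\<^sup>2"
proof -
  define g where "g i = [f, f1, f2] ! i" for i
  have g: "g 0 = f" "g (Suc 0) = f1" "g 2 = f2"
    by (auto simp: g_def numeral_eq_Suc)
  have "(g i has_real_derivative g (Suc i) z) (at z within S)" if "z \<in> S" "i \<le> 1" for z i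
    using f[OF that(1)] f1[OF that(1)] that(2) by (auto simp: g_def le_Suc_eq)
  moreover have "norm (g (Suc 1) z) \<le> B" if "z \<in> S" for z
    using B[OF that] g(3) by (simp add: numeral_2_eq_2)
  ultimately have "norm (g 0 y - (\<Sum>i\<le>1. g i x * (y - x) ^ i / fact i))
      \<le> B * norm (y - x) ^ Suc 1 / fact 1"
    using field_Taylor[of S 1 g B x y] S by blast
  then show ?thesis
    by (simp add: g(1,2) diff_diff_eq power2_eq_square)
qed

text \<open>One factor is exchanged at a time, so only \<open>x\<close> and \<open>y'\<close> need
  bounds. Later \<open>y\<close> can be a difference quotient for which no bound of its own is at
  hand.\<close>

lemma abs_mult_diff_le:
  fixes x y :: real
  assumes "\<bar>x - x'\<bar> \<le> d" "\<bar>y - y'\<bar> \<le> e" "\<bar>x\<bar> \<le> K" "\<bar>y'\<bar> \<le> K"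
  shows "\<bar>x * y - x' * y'\<bar> \<le> K * (d + e)"
proof -
  have "x * y - x' * y' = x * (y - y') + (x - x') * y'"
    by (simp add: algebra_simps)
  also have "\<bar>\<dots>\<bar> \<le> \<bar>x\<bar> * \<bar>y - y'\<bar> + \<bar>x - x'\<bar> * \<bar>y'\<bar>"
    by (metis abs_mult abs_triangle_ineq)
  also have "\<dots> \<le> K * e + d * K"
    using assms by (intro add_mono mult_mono) auto
  finally show ?thesis by (simp add: algebra_simps)
qed

section \<open>Integration against the weakly singular kernel\<close>

text \<open>For negative \<open>\<beta>\<close> the integrand is unbounded near
  \<open>q = t\<close>. The antiderivative stays continuous there because
  \<open>\<beta> + 1 > 0\<close>, so derivatives in the open interval suffice for the fundamental
  theorem.\<close>

lemma has_integral_reflected_powr: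
  fixes \<beta> p q t :: real
  assumes "\<beta> > -1" "p \<le> q" "q \<le> t"
  shows "((\<lambda>x. (t - x) powr \<beta>) has_integral
           ((t - p) powr (\<beta> + 1) - (t - q) powr (\<beta> + 1)) / (\<beta> + 1)) {p..q}"
proof -
  have "((\<lambda>x. (t - x) powr \<beta>) has_integral
          (- ((t - q) powr (\<beta> + 1) / (\<beta> + 1)) - - ((t - p) powr (\<beta> + 1) / (\<beta> + 1)))) {p..q}"
  proof (rule fundamental_theorem_of_calculus_interior)
    show "continuous_on {p..q} (\<lambda>x. - ((t - x) powr (\<beta> + 1) / (\<beta> + 1)))"
      using assms by (intro continuous_intros continuous_on_powr') auto
    show "((\<lambda>x. - ((t - x) powr (\<beta> + 1) / (\<beta> + 1))) has_vector_derivative (t - x) powr \<beta>) (at x)"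
      if "x \<in> {p<..<q}" for x
    proof -
      have "((\<lambda>x. (t - x) powr (\<beta> + 1)) has_real_derivative - ((\<beta> + 1) * (t - x) powr \<beta>)) (at x)"
        using assms that by (auto intro!: derivative_eq_intros)
      from DERIV_minus[OF DERIV_cdivide[OF this, of "\<beta> + 1"]] show ?thesis
        using assms by (simp add: has_real_derivative_iff_has_vector_derivative)
    qed
  qed (use assms in auto)
  then show ?thesis by (simp add: diff_divide_distrib)
qed

text \<open>Writing \<open>x - m = (t - m) - (t - x)\<close> splits the integrand into two pure
  powers of \<open>t - x\<close>.\<close>

lemma has_integral_weighted_linear:
  fixes \<alpha> p q t m :: real
  assumes "\<alpha> < 1" "p \<le> q" "q \<le> t"
  shows "((\<lambda>x. (t - x) powr (-\<alpha>) * (x - m)) has_integral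
           (t - m) * (((t - p) powr (1 - \<alpha>) - (t - q) powr (1 - \<alpha>)) / (1 - \<alpha>))
           - ((t - p) powr (2 - \<alpha>) - (t - q) powr (2 - \<alpha>)) / (2 - \<alpha>)) {p..q}"
proof -
  have "((\<lambda>x. (t - m) * (t - x) powr (-\<alpha>) - (t - x) powr (1 - \<alpha>)) has_integral
      (t - m) * (((t - p) powr (-\<alpha> + 1) - (t - q) powr (-\<alpha> + 1)) / (-\<alpha> + 1))
           - ((t - p) powr (1 - \<alpha> + 1) - (t - q) powr (1 - \<alpha> + 1)) / (1 - \<alpha> + 1)) {p..q}"
    using assms by (intro has_integral_diff has_integral_mult_right has_integral_reflected_powr) auto
  moreover have "(t - m) * (t - x) powr (-\<alpha>) - (t - x) powr (1 - \<alpha>) = (t - x) powr (-\<alpha>) * (x - m)"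
    if "x \<in> {p..q}" for x
  \<comment> \<open>At the singular point the convention \<open>0 powr y = 0\<close> makes both
    sides vanish.\<close>
  proof (cases "x = t")
    case False
    with that assms have "(t - x) powr (1 - \<alpha>) = (t - x) * (t - x) powr (-\<alpha>)"
      by (simp add: powr_diff powr_minus divide_inverse)
    then show ?thesis by (simp add: algebra_simps)
  qed auto
  ultimately have "((\<lambda>x. (t - x) powr (-\<alpha>) * (x - m)) has_integral
      (t - m) * (((t - p) powr (-\<alpha> + 1) - (t - q) powr (-\<alpha> + 1)) / (-\<alpha> + 1))
           - ((t - p) powr (1 - \<alpha> + 1) - (t - q) powr (1 - \<alpha> + 1)) / (1 - \<alpha> + 1)) {p..q}"
    by (rule has_integral_eq[rotated])
  moreover have "-\<alpha> + 1 = 1 - \<alpha>" "1 - \<alpha> + 1 = 2 - \<alpha>" by auto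
  ultimately show ?thesis by (simp only:)
qed

text \<open>The kernel is absolutely integrable for \<open>\<alpha> < 1\<close>, and a continuous
  factor on a compact interval is bounded and measurable.\<close>

lemma integrable_weight_mult_continuous:
  fixes \<alpha> t :: real
  assumes "\<alpha> < 1" "0 \<le> t" "continuous_on {0..t} F"
  shows "(\<lambda>x. (t - x) powr (-\<alpha>) * F x) integrable_on {0..t}"
proof -
  have "(\<lambda>x. (t - x) powr (-\<alpha>)) absolutely_integrable_on {0..t}"
    using has_integral_reflected_powr[of "-\<alpha>" 0 t t] assms
    by (intro nonnegative_absolutely_integrable_1) (auto simp: integrable_on_def)
  moreover have "F \<in> borel_measurable (lebesgue_on {0..t})"
    using assms by (intro continuous_imp_measurable_on_sets_lebesgue) auto
  moreover have "bounded (F ` {0..t})"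
    using assms by (intro compact_imp_bounded compact_continuous_image) auto
  ultimately have "(\<lambda>x. F x * (t - x) powr (-\<alpha>)) absolutely_integrable_on {0..t}"
    by (intro absolutely_integrable_bounded_measurable_product_real) auto
  then show ?thesis
    by (simp add: mult.commute set_lebesgue_integral_eq_integral(1))
qed

text \<open>\<open>W0\<close> and \<open>W1\<close> are the kernel moments of order 0 and 1 about
  \<open>m\<close> in closed form. As the kernel is nonnegative, a pointwise error \<open>D\<close>
  integrates to at most \<open>D * W0\<close>.\<close>

lemma weighted_integral_error:
  fixes \<alpha> p q t D :: real
  assumes "\<alpha> < 1" "0 \<le> p" "p \<le> q" "q \<le> t" "continuous_on {0..t} F"
    and err: "\<And>x. x \<in> {p..q} \<Longrightarrow> \<bar>F x - (A + B * (x - m))\<bar> \<le> D"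
  defines "W0 \<equiv> ((t - p) powr (1 - \<alpha>) - (t - q) powr (1 - \<alpha>)) / (1 - \<alpha>)"
    and "W1 \<equiv> (t - m) * (((t - p) powr (1 - \<alpha>) - (t - q) powr (1 - \<alpha>)) / (1 - \<alpha>))
           - ((t - p) powr (2 - \<alpha>) - (t - q) powr (2 - \<alpha>)) / (2 - \<alpha>)"
  shows "\<bar>integral {p..q} (\<lambda>x. (t - x) powr (-\<alpha>) * F x) - (A * W0 + B * W1)\<bar> \<le> D * W0"
proof -
  define w where "w x = (t - x) powr (-\<alpha>)" for x
  have W0: "(w has_integral W0) {p..q}"
    using has_integral_reflected_powr[of "-\<alpha>" p q t] assms(1-4)
    unfolding w_def W0_def by (simp add: add.commute)
  have W1: "((\<lambda>x. w x * (x - m)) has_integral W1) {p..q}"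
    unfolding w_def W1_def using assms(1-4) by (intro has_integral_weighted_linear)
  have "(\<lambda>x. w x * F x) integrable_on {p..q}"
    unfolding w_def
    using integrable_weight_mult_continuous[of \<alpha> t F] assms(1-5)
    by (auto elim!: integrable_subinterval_real)
  then have F: "((\<lambda>x. w x * F x) has_integral integral {p..q} (\<lambda>x. w x * F x)) {p..q}"
    by (rule integrable_integral)
  have lin: "((\<lambda>x. A * w x + B * (w x * (x - m))) has_integral (A * W0 + B * W1)) {p..q}"
    by (intro has_integral_add has_integral_mult_right W0 W1)
  have "\<bar>w x * F x - (A * w x + B * (w x * (x - m)))\<bar> \<le> D * w x" if "x \<in> {p..q}" for x
  proof -
    have "w x * F x - (A * w x + B * (w x * (x - m))) = w x * (F x - (A + B * (x - m)))"
      by (simp add: algebra_simps)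
    also have "\<bar>\<dots>\<bar> = w x * \<bar>F x - (A + B * (x - m))\<bar>"
      by (simp add: abs_mult w_def)
    also have "\<dots> \<le> w x * D"
      using err[OF that] by (intro mult_left_mono) (auto simp: w_def)
    finally show ?thesis by (simp add: mult.commute)
  qed
  then have "norm (integral {p..q} (\<lambda>x. w x * F x - (A * w x + B * (w x * (x - m)))))
      \<le> integral {p..q} (\<lambda>x. D * w x)"
    using has_integral_diff[OF F lin] has_integral_mult_right[OF W0, of D]
    by (intro integral_norm_bound_integral) (auto simp: integrable_on_def)
  then show ?thesis
    using integral_unique[OF has_integral_diff[OF F lin]]
      integral_unique[OF has_integral_mult_right[OF W0, of D]]
    by (simp only: w_def real_norm_def)
qed

section \<open>Coefficients of the discrete operator\<close>

text \<open>The left sides are the kernel moments of a full cell at distances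
  \<open>(l + \<sigma>) * \<tau>\<close> to \<open>(l + 1 + \<sigma>) * \<tau>\<close> from
  \<open>t\<close>, the moment of order 1 being about the midpoint. Its extra factor
  \<open>\<tau>\<close> later cancels the denominator of the slope.\<close>

lemma powr_weights_scaled:
  fixes \<alpha> \<sigma> \<tau> :: real
  assumes "0 < \<alpha>" "\<alpha> < 1" "0 < \<sigma>" "0 < \<tau>"
  shows "(((real (Suc l) + \<sigma>) * \<tau>) powr (1 - \<alpha>) - ((real l + \<sigma>) * \<tau>) powr (1 - \<alpha>)) / (1 - \<alpha>)
          = \<tau> powr (1 - \<alpha>) / (1 - \<alpha>) * coeff_a \<alpha> \<sigma> (Suc l)" (is ?A)
    and "(real (Suc l) + \<sigma> - 1/2) * \<tau> *
          ((((real (Suc l) + \<sigma>) * \<tau>) powr (1 - \<alpha>) - ((real l + \<sigma>) * \<tau>) powr (1 - \<alpha>)) / (1 - \<alpha>))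
          - (((real (Suc l) + \<sigma>) * \<tau>) powr (2 - \<alpha>) - ((real l + \<sigma>) * \<tau>) powr (2 - \<alpha>)) / (2 - \<alpha>)
          = \<tau> * (\<tau> powr (1 - \<alpha>) / (1 - \<alpha>) * coeff_b \<alpha> \<sigma> (Suc l))" (is ?B)
proof -
  define X where "X = real l + \<sigma>"
  define P Q where "P = (X + 1) powr (1 - \<alpha>)" and "Q = X powr (1 - \<alpha>)"
  define R where "R = \<tau> powr (1 - \<alpha>)"
  have X: "X > 0" using assms by (simp add: X_def)
  have e: "real (Suc l) + \<sigma> = X + 1" "real (Suc l) - 1 + \<sigma> = X" "real l + \<sigma> = X"
    by (simp_all add: X_def)
  have pow: "y powr (2 - \<alpha>) = y * y powr (1 - \<alpha>)" if "y > 0" for y :: real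
    using that powr_add[of y 1 "1 - \<alpha>"] by simp
  have s1: "((X + 1) * \<tau>) powr (1 - \<alpha>) = P * R" "(X * \<tau>) powr (1 - \<alpha>) = Q * R"
    using X assms by (simp_all add: P_def Q_def R_def powr_mult)
  have s2: "((X + 1) * \<tau>) powr (2 - \<alpha>) = (X + 1) * \<tau> * (P * R)"
     "(X * \<tau>) powr (2 - \<alpha>) = X * \<tau> * (Q * R)"
     "(X + 1) powr (2 - \<alpha>) = (X + 1) * P" "X powr (2 - \<alpha>) = X * Q"
    using X assms pow[of "(X + 1) * \<tau>"] pow[of "X * \<tau>"] pow[of "X + 1"] pow[of X]
    by (simp_all add: s1) (simp_all add: P_def Q_def)
  have a: "coeff_a \<alpha> \<sigma> (Suc l) = P - Q"
    unfolding coeff_a_def e by (simp add: P_def Q_def)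
  have b: "coeff_b \<alpha> \<sigma> (Suc l) = ((X + 1) * P - X * Q) / (2 - \<alpha>) - (P + Q) / 2"
    unfolding coeff_b_def e s2 by (simp add: P_def Q_def)
  show ?A unfolding e s1 a R_def[symmetric] by (simp add: algebra_simps)
  \<comment> \<open>With every power \<open>2 - \<alpha>\<close> reduced to
    \<open>1 - \<alpha>\<close>, the claim is a rational identity; \<open>u\<close> stands for
    \<open>1 - \<alpha>\<close>.\<close>
  have "(X + 1 - 1/2) * \<tau> * ((P * R - Q * R) / u) - ((X + 1) * \<tau> * (P * R) - X * \<tau> * (Q * R)) / (u + 1)
      = \<tau> * (R / u * (((X + 1) * P - X * Q) / (u + 1) - (P + Q) / 2))"
    if "u > 0" for u :: real
    using that by (simp add: field_simps)
  from this[of "1 - \<alpha>"] show ?B unfolding e s1 s2 b R_def[symmetric] using assms by simp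
qed

text \<open>Summation by parts: \<open>coeff_b\<close> at index \<open>l\<close> enters
  \<open>coeff_c\<close> at \<open>l - 1\<close> with a plus and at \<open>l\<close> with a minus
  sign. Collecting both occurrences turns the sum over difference quotients into a sum over cells,
  the last cell standing apart.\<close>

lemma sum_coeff_c_regroup:
  fixes d :: "nat \<Rightarrow> real"
  shows "(\<Sum>s=0..j. coeff_c \<alpha> \<sigma> \<tau> lam j (j - s) * d s) =
    (\<Sum>k<j. lam ((real (j - k) + \<sigma> - 1/2) * \<tau>) * coeff_a \<alpha> \<sigma> (j - k) * d k
       + coeff_b \<alpha> \<sigma> (j - k) * (lam ((real (j - Suc k) + \<sigma>) * \<tau>) * d (Suc k)
           - lam ((real (j - k) + \<sigma>) * \<tau>) * d k))
    + lam ((\<sigma> - 1/2) * \<tau>) * coeff_a \<alpha> \<sigma> 0 * d j"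
proof -
  define a where "a l = lam ((real l + \<sigma> - 1/2) * \<tau>) * coeff_a \<alpha> \<sigma> l" for l
  define L where "L l = lam ((real l + \<sigma>) * \<tau>)" for l
  define b where "b = coeff_b \<alpha> \<sigma>"
  \<comment> \<open>A single formula for all branches of \<open>coeff_c\<close>; for
    \<open>j = 0\<close> both conditions are false.\<close>
  have c: "coeff_c \<alpha> \<sigma> \<tau> lam j s = a s + (if s < j then L s * b (s + 1) else 0) - (if s > 0 then L s * b s else 0)"
    if "s \<le> j" for s
    using that by (auto simp: coeff_c_def Let_def a_def L_def b_def)
  have "(\<Sum>s=0..j. coeff_c \<alpha> \<sigma> \<tau> lam j (j - s) * d s) =
    (\<Sum>s<Suc j. a (j - s) * d s + (if 0 < s then L (j - s) * b (j - s + 1) * d s else 0)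
       - (if s < j then L (j - s) * b (j - s) * d s else 0))"
    unfolding atLeast0AtMost lessThan_Suc_atMost
    by (intro sum.cong) (auto simp: c algebra_simps)
  also have "\<dots> = (\<Sum>s<Suc j. a (j - s) * d s)
      + (\<Sum>s<Suc j. if 0 < s then L (j - s) * b (j - s + 1) * d s else 0)
      - (\<Sum>s<Suc j. if s < j then L (j - s) * b (j - s) * d s else 0)"
    by (simp only: sum_subtractf sum.distrib)
  \<comment> \<open>The guard removes \<open>s = 0\<close>, and the shift \<open>s = Suc k\<close>
    turns \<open>j - s + 1\<close> into \<open>j - k\<close>.\<close>
  also have "(\<Sum>s<Suc j. if 0 < s then L (j - s) * b (j - s + 1) * d s else 0)
      = (\<Sum>k<j. L (j - Suc k) * b (j - k) * d (Suc k))"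
    unfolding sum.lessThan_Suc_shift by (auto intro!: sum.cong simp: Suc_diff_Suc)
  also have "(\<Sum>s<Suc j. if s < j then L (j - s) * b (j - s) * d s else 0)
      = (\<Sum>k<j. L (j - k) * b (j - k) * d k)"
    by simp
  also have "(\<Sum>s<Suc j. a (j - s) * d s) = (\<Sum>k<j. a (j - k) * d k) + a 0 * d j"
    by simp
  finally have "(\<Sum>s=0..j. coeff_c \<alpha> \<sigma> \<tau> lam j (j - s) * d s) =
    (\<Sum>k<j. a (j - k) * d k + b (j - k) * (L (j - Suc k) * d (Suc k) - L (j - k) * d k)) + a 0 * d j"
    by (simp add: sum.distrib sum_subtractf algebra_simps)
  then show ?thesis by (simp add: a_def L_def b_def)
qed


section \<open>Local errors on single cells\<close>

text \<open>
  Here \<open>b\<close> and \<open>t\<close> stand for \<open>t\<^sub>j\<^sub>+\<^sub>1\<close> and \<open>t\<^sub>j\<^sub>+\<^sub>\<sigma>\<close>.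
\<close>

locale smooth_caputo_data =
  fixes b t K :: real and lam lam1 lam2 v v1 v2 v3 :: "real \<Rightarrow> real"
  assumes t: "0 \<le> t" "t \<le> b"
    and lam: "\<And>x. x \<in> {0..b} \<Longrightarrow> (lam has_real_derivative lam1 x) (at x within {0..b})"
    and lam1: "\<And>x. x \<in> {0..b} \<Longrightarrow> (lam1 has_real_derivative lam2 x) (at x within {0..b})"
    and v: "\<And>x. x \<in> {0..b} \<Longrightarrow> (v has_real_derivative v1 x) (at x within {0..b})"
    and v1: "\<And>x. x \<in> {0..b} \<Longrightarrow> (v1 has_real_derivative v2 x) (at x within {0..b})"
    and v2: "\<And>x. x \<in> {0..b} \<Longrightarrow> (v2 has_real_derivative v3 x) (at x within {0..b})"
    and lam_bound: "\<And>x. x \<in> {0..b} \<Longrightarrow> \<bar>lam x\<bar> \<le> K"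
    and lam1_bound: "\<And>x. x \<in> {0..b} \<Longrightarrow> \<bar>lam1 x\<bar> \<le> K"
    and lam2_bound: "\<And>x. x \<in> {0..b} \<Longrightarrow> \<bar>lam2 x\<bar> \<le> K"
    and v1_bound: "\<And>x. x \<in> {0..b} \<Longrightarrow> \<bar>v1 x\<bar> \<le> K"
    and v2_bound: "\<And>x. x \<in> {0..b} \<Longrightarrow> \<bar>v2 x\<bar> \<le> K"
    and v3_bound: "\<And>x. x \<in> {0..b} \<Longrightarrow> \<bar>v3 x\<bar> \<le> K"
begin

text \<open>The smooth factor of the Caputo integrand. \<open>F1\<close> and \<open>F2\<close> are
  its first two derivatives; each derivative of \<open>lam\<close> brings a minus sign from the
  reflection.\<close>

definition "F x = lam (t - x) * v1 x"

definition "F1 x = lam (t - x) * v2 x - lam1 (t - x) * v1 x"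

definition "F2 x = lam (t - x) * v3 x - 2 * (lam1 (t - x) * v2 x) + lam2 (t - x) * v1 x"

lemma K_nonneg: "0 \<le> K"
  using lam_bound[of 0] t by auto

text \<open>Chain rule for one-sided derivatives: the reflection maps \<open>{0..t}\<close> onto
  itself, and this set lies in \<open>{0..b}\<close>.\<close>

lemma reflect_derivative:
  assumes "\<And>x. x \<in> {0..b} \<Longrightarrow> (f has_real_derivative f' x) (at x within {0..b})" "x \<in> {0..t}"
  shows "((\<lambda>x. f (t - x)) has_real_derivative - f' (t - x)) (at x within {0..t})"
proof -
  have "(f has_real_derivative f' (t - x)) (at (t - x) within (-) t ` {0..t})"
    using assms t by (intro has_field_derivative_subset[OF assms(1)]) auto
  moreover have "((-) t has_real_derivative -1) (at x within {0..t})"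
    by (auto intro!: derivative_eq_intros)
  ultimately show ?thesis
    using DERIV_image_chain by (fastforce simp: o_def)
qed

lemma restrict_derivative:
  assumes "\<And>x. x \<in> {0..b} \<Longrightarrow> (f has_real_derivative f' x) (at x within {0..b})" "x \<in> {0..t}"
  shows "(f has_real_derivative f' x) (at x within {0..t})"
  using assms t by (intro has_field_derivative_subset[OF assms(1)]) auto

lemma F_derivative: "x \<in> {0..t} \<Longrightarrow> (F has_real_derivative F1 x) (at x within {0..t})"
  unfolding F_def F1_def
  by (rule DERIV_cong[OF DERIV_mult[OF reflect_derivative[OF lam] restrict_derivative[OF v1]]]) auto

lemma F1_derivative: "x \<in> {0..t} \<Longrightarrow> (F1 has_real_derivative F2 x) (at x within {0..t})"
  unfolding F1_def F2_def
  by (rule DERIV_cong[OF DERIV_diff[OF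
        DERIV_mult[OF reflect_derivative[OF lam] restrict_derivative[OF v2]]
        DERIV_mult[OF reflect_derivative[OF lam1] restrict_derivative[OF v1]]]]) auto

lemma F_continuous: "continuous_on {0..t} F"
  using F_derivative by (rule DERIV_continuous_on)

text \<open>The constant counts 1 + 2 + 1 products of two factors bounded by
  \<open>K\<close>.\<close>

lemma F2_bound:
  assumes "x \<in> {0..t}"
  shows "\<bar>F2 x\<bar> \<le> 4 * K\<^sup>2"
proof -
  have "x \<in> {0..b}" "t - x \<in> {0..b}" using assms t by auto
  then have "\<bar>lam (t - x) * v3 x\<bar> \<le> K * K" "\<bar>lam1 (t - x) * v2 x\<bar> \<le> K * K"
    "\<bar>lam2 (t - x) * v1 x\<bar> \<le> K * K"
    unfolding abs_mult
    by (intro mult_mono lam_bound lam1_bound lam2_bound v1_bound v2_bound v3_bound K_nonneg; simp)+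
  then show ?thesis unfolding F2_def power2_eq_square by linarith
qed

lemma F_Taylor:
  assumes "x \<in> {0..t}" "m \<in> {0..t}" "\<bar>x - m\<bar> \<le> h"
  shows "\<bar>F x - F m - F1 m * (x - m)\<bar> \<le> 4 * K\<^sup>2 * h\<^sup>2"
proof -
  have "\<bar>F x - F m - F1 m * (x - m)\<bar> \<le> 4 * K\<^sup>2 * (x - m)\<^sup>2"
    by (intro first_order_Taylor_bound[of "{0..t}" F F1 F2] F_derivative F1_derivative F2_bound assms)
      auto
  also have "\<dots> \<le> 4 * K\<^sup>2 * h\<^sup>2"
    using assms(3) by (intro mult_left_mono) (auto simp: abs_le_square_iff[symmetric])
  finally show ?thesis .
qed

text \<open>A forward difference over a cell is a central difference with half-step
  \<open>\<tau> / 2\<close> about the midpoint; this symmetry gives the second order.\<close>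

lemma divided_difference_error:
  assumes "0 < \<tau>" "0 \<le> p" "p + \<tau> \<le> b"
  shows "\<bar>(v (p + \<tau>) - v p) / \<tau> - v1 (p + \<tau> / 2)\<bar> \<le> K * \<tau>\<^sup>2"
proof -
  have "\<bar>v (p + \<tau> / 2 + \<tau> / 2) - v (p + \<tau> / 2 - \<tau> / 2) - 2 * (v1 (p + \<tau> / 2) * (\<tau> / 2))\<bar>
      \<le> K * (\<tau> / 2) ^ 3"
    by (rule central_difference_bounds(2)[of "{0..b}", OF v v1 v2 v3_bound]) (use assms in auto)
  then have "\<bar>v (p + \<tau>) - v p - v1 (p + \<tau> / 2) * \<tau>\<bar> \<le> K * (\<tau> / 2) ^ 3"
    by (simp add: add.assoc)
  also have "\<dots> \<le> K * \<tau> ^ 3"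
    using assms K_nonneg by (intro mult_left_mono power_mono) auto
  finally have "\<bar>v (p + \<tau>) - v p - v1 (p + \<tau> / 2) * \<tau>\<bar> / \<tau> \<le> K * \<tau> ^ 3 / \<tau>"
    using assms by (intro divide_right_mono) auto
  moreover have "(v (p + \<tau>) - v p) / \<tau> - v1 (p + \<tau> / 2) = (v (p + \<tau>) - v p - v1 (p + \<tau> / 2) * \<tau>) / \<tau>"
    using assms by (simp add: field_simps)
  ultimately show ?thesis
    using assms by (simp add: abs_divide power3_eq_cube power2_eq_square)
qed

text \<open>The weight is taken exactly at the midpoint, so only the factor \<open>v1\<close>
  contributes an error.\<close>

lemma midpoint_value_error:
  assumes "0 < \<tau>" "0 \<le> p" "p + \<tau> \<le> b" "p + \<tau> / 2 \<le> t"
  shows "\<bar>lam (t - (p + \<tau> / 2)) * ((v (p + \<tau>) - v p) / \<tau>) - F (p + \<tau> / 2)\<bar> \<le> K\<^sup>2 * \<tau>\<^sup>2"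
proof -
  have "\<bar>lam (t - (p + \<tau> / 2)) * ((v (p + \<tau>) - v p) / \<tau>) - lam (t - (p + \<tau> / 2)) * v1 (p + \<tau> / 2)\<bar>
      \<le> K * (0 + K * \<tau>\<^sup>2)"
    using assms t
    by (intro abs_mult_diff_le divided_difference_error lam_bound v1_bound) auto
  then show ?thesis by (simp add: F_def power2_eq_square)
qed

text \<open>The last cell is cut off at \<open>t\<close>, but the quotient and the midpoint are
  those of the whole cell. The exact slope \<open>F1 m\<close> is admissible because its weight will
  vanish for the chosen \<open>\<sigma>\<close>. The constant 4 + 1 is enlarged to the 10 of the
  full cells.\<close>

lemma last_cell_error:
  assumes "0 < \<tau>" "0 \<le> p" "p + \<tau> \<le> b" "p + \<tau> / 2 \<le> t" "x \<in> {p..t}" "t \<le> p + \<tau>"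
  defines "m \<equiv> p + \<tau> / 2"
  shows "\<bar>F x - (lam (t - m) * ((v (p + \<tau>) - v p) / \<tau>) + F1 m * (x - m))\<bar> \<le> 10 * K\<^sup>2 * \<tau>\<^sup>2"
proof -
  have "\<bar>F x - F m - F1 m * (x - m)\<bar> \<le> 4 * K\<^sup>2 * \<tau>\<^sup>2"
    by (rule F_Taylor) (use assms in \<open>auto simp: m_def\<close>)
  moreover have "\<bar>lam (t - m) * ((v (p + \<tau>) - v p) / \<tau>) - F m\<bar> \<le> K\<^sup>2 * \<tau>\<^sup>2"
    unfolding m_def using assms by (intro midpoint_value_error)
  moreover have "0 \<le> K\<^sup>2 * \<tau>\<^sup>2" by simp
  ultimately show ?thesis by linarith
qed

text \<open>A discrete product rule: the slope is \<open>lam\<close> times a second difference of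
  \<open>v\<close> minus a difference quotient of \<open>lam\<close> times \<open>d\<close>,
  matching the two terms of \<open>F1\<close>. It uses one node beyond the cell, which may exceed
  \<open>t\<close> but not \<open>b\<close>.\<close>

lemma slope_error:
  assumes "0 < \<tau>" "0 \<le> p" "p + \<tau> \<le> t" "p + 2 * \<tau> \<le> b"
  defines "m \<equiv> p + \<tau> / 2" and "d \<equiv> (v (p + \<tau>) - v p) / \<tau>"
    and "d' \<equiv> (v (p + 2 * \<tau>) - v (p + \<tau>)) / \<tau>"
  shows "\<bar>(lam (t - (p + \<tau>)) * d' - lam (t - p) * d) / \<tau> - F1 m\<bar> \<le> 5 * K\<^sup>2 * \<tau>"
proof -
  define q where "q = p + \<tau>"
  have q: "q + \<tau> = p + 2 * \<tau>" "q - \<tau> = p" by (auto simp: q_def)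
  have lip: "\<bar>f x - f y\<bar> \<le> K * \<bar>x - y\<bar>"
    if "\<And>x. x \<in> {0..b} \<Longrightarrow> (f has_real_derivative f' x) (at x within {0..b})"
      "\<And>x. x \<in> {0..b} \<Longrightarrow> \<bar>f' x\<bar> \<le> K" "x \<in> {0..b}" "y \<in> {0..b}"
    for f f' :: "real \<Rightarrow> real" and x y
    using field_differentiable_bound[of "{0..b}" f f' K x y] that by auto
  have Kt: "K * (\<tau> / 2) \<le> K * \<tau>"
    using K_nonneg assms(1) by (intro mult_left_mono) auto
  \<comment> \<open>The second difference is centred at the node \<open>q\<close>; moving from
    \<open>q\<close> to the midpoint costs another \<open>K * \<tau>\<close>.\<close>
  have "\<bar>v (q + \<tau>) - 2 * v q + v (q - \<tau>) - v2 q * \<tau>\<^sup>2\<bar> \<le> K * \<tau> ^ 3"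
    by (rule central_difference_bounds(1)[of "{0..b}", OF v v1 v2 v3_bound])
      (use assms t in \<open>auto simp: q_def\<close>)
  then have "\<bar>v (q + \<tau>) - 2 * v q + v (q - \<tau>) - v2 q * \<tau>\<^sup>2\<bar> / \<tau>\<^sup>2 \<le> K * \<tau> ^ 3 / \<tau>\<^sup>2"
    by (intro divide_right_mono) auto
  moreover have "(d' - d) / \<tau> - v2 q = (v (q + \<tau>) - 2 * v q + v (q - \<tau>) - v2 q * \<tau>\<^sup>2) / \<tau>\<^sup>2"
    unfolding d_def d'_def q q_def[symmetric] using assms(1)
    by (simp add: field_simps power2_eq_square)
  ultimately have "\<bar>(d' - d) / \<tau> - v2 q\<bar> \<le> K * \<tau>"
    using assms(1) by (simp add: abs_divide power3_eq_cube power2_eq_square)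
  moreover have "\<bar>v2 q - v2 m\<bar> \<le> K * \<bar>q - m\<bar>"
    by (rule lip[OF v2 v3_bound]) (use assms t in \<open>auto simp: q_def m_def\<close>)
  then have "\<bar>v2 q - v2 m\<bar> \<le> K * \<tau>"
    using assms(1) Kt by (simp add: q_def m_def)
  ultimately have D: "\<bar>(d' - d) / \<tau> - v2 m\<bar> \<le> 2 * (K * \<tau>)"
    by linarith
  have "\<bar>lam (t - q) - lam (t - m)\<bar> \<le> K * \<bar>(t - q) - (t - m)\<bar>"
    by (rule lip[OF lam lam1_bound]) (use assms t in \<open>auto simp: q_def m_def\<close>)
  then have L: "\<bar>lam (t - q) - lam (t - m)\<bar> \<le> K * \<tau>"
    using assms(1) Kt by (simp add: q_def m_def)
  have 1: "\<bar>lam (t - q) * ((d' - d) / \<tau>) - lam (t - m) * v2 m\<bar> \<le> K * (K * \<tau> + 2 * (K * \<tau>))"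
    by (intro abs_mult_diff_le L D lam_bound v2_bound) (use assms t in \<open>auto simp: q_def m_def\<close>)
  \<comment> \<open>Mean values express both quotients exactly; the intermediate points lie within
    \<open>\<tau>\<close> of \<open>m\<close> and of \<open>t - m\<close>.\<close>
  have "\<exists>x\<in>{p..q}. v q - v p = v1 x * (q - p)"
    by (rule mvt_very_simple)
      (use assms t in \<open>auto simp: q_def has_field_derivative_def[symmetric]
        intro!: has_field_derivative_subset[OF v]\<close>)
  then obtain x where x: "x \<in> {p..q}" "v q - v p = v1 x * \<tau>" by (auto simp: q_def)
  have "\<exists>y\<in>{t-q..t-p}. lam (t - p) - lam (t - q) = lam1 y * ((t - p) - (t - q))"
    by (rule mvt_very_simple)
      (use assms t in \<open>auto simp: q_def has_field_derivative_def[symmetric]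
        intro!: has_field_derivative_subset[OF lam]\<close>)
  then obtain y where y: "y \<in> {t-q..t-p}" "lam (t - p) - lam (t - q) = lam1 y * \<tau>"
    by (auto simp: q_def)
  have d: "d = v1 x" using x assms(1) by (simp add: d_def q_def)
  have "\<bar>v1 x - v1 m\<bar> \<le> K * \<bar>x - m\<bar>"
    by (rule lip[OF v1 v2_bound]) (use x assms t in \<open>auto simp: q_def m_def\<close>)
  also have "\<dots> \<le> K * \<tau>"
    using x K_nonneg assms(1) by (intro mult_left_mono) (auto simp: q_def m_def)
  finally have V: "\<bar>v1 x - v1 m\<bar> \<le> K * \<tau>" .
  have "\<bar>lam1 y - lam1 (t - m)\<bar> \<le> K * \<bar>y - (t - m)\<bar>"
    by (rule lip[OF lam1 lam2_bound]) (use y assms t in \<open>auto simp: q_def m_def\<close>)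
  also have "\<dots> \<le> K * \<tau>"
    using y K_nonneg assms(1) by (intro mult_left_mono) (auto simp: q_def m_def)
  finally have L1: "\<bar>lam1 y - lam1 (t - m)\<bar> \<le> K * \<tau>" .
  have 2: "\<bar>lam1 y * v1 x - lam1 (t - m) * v1 m\<bar> \<le> K * (K * \<tau> + K * \<tau>)"
    by (intro abs_mult_diff_le L1 V lam1_bound v1_bound) (use y assms t in \<open>auto simp: q_def m_def\<close>)
  have "(lam (t - q) * d' - lam (t - p) * d) / \<tau>
      = lam (t - q) * ((d' - d) / \<tau>) - (lam (t - p) - lam (t - q)) / \<tau> * d"
    using assms(1) by (simp add: field_simps)
  also have "(lam (t - p) - lam (t - q)) / \<tau> * d = lam1 y * v1 x"
    using assms(1) y(2) d by simp
  finally have "\<bar>(lam (t - q) * d' - lam (t - p) * d) / \<tau> - F1 m\<bar>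
      \<le> K * (K * \<tau> + 2 * (K * \<tau>)) + K * (K * \<tau> + K * \<tau>)"
    unfolding F1_def using 1 2 by linarith
  also have "\<dots> = 5 * K\<^sup>2 * \<tau>" by (simp add: power2_eq_square algebra_simps)
  finally show ?thesis unfolding q_def .
qed

text \<open>Taylor remainder, midpoint value and slope contribute 4, 1 and 5. The slope error has
  only order \<open>\<tau>\<close>, but it is multiplied by
  \<open>\<bar>x - m\<bar> \<le> \<tau>\<close>.\<close>

lemma interior_cell_error:
  assumes "0 < \<tau>" "0 \<le> p" "p + \<tau> \<le> t" "p + 2 * \<tau> \<le> b" "x \<in> {p..p + \<tau>}"
  defines "m \<equiv> p + \<tau> / 2" and "d \<equiv> (v (p + \<tau>) - v p) / \<tau>"
    and "d' \<equiv> (v (p + 2 * \<tau>) - v (p + \<tau>)) / \<tau>"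
  shows "\<bar>F x - (lam (t - m) * d + (lam (t - (p + \<tau>)) * d' - lam (t - p) * d) / \<tau> * (x - m))\<bar>
           \<le> 10 * K\<^sup>2 * \<tau>\<^sup>2"
proof -
  define B where "B = (lam (t - (p + \<tau>)) * d' - lam (t - p) * d) / \<tau>"
  have xm: "\<bar>x - m\<bar> \<le> \<tau>" using assms(1,5) by (auto simp: m_def)
  have "\<bar>F x - F m - F1 m * (x - m)\<bar> \<le> 4 * K\<^sup>2 * \<tau>\<^sup>2"
    by (rule F_Taylor) (use assms xm in \<open>auto simp: m_def\<close>)
  moreover have "\<bar>lam (t - m) * d - F m\<bar> \<le> K\<^sup>2 * \<tau>\<^sup>2"
    unfolding m_def d_def using assms by (intro midpoint_value_error) auto
  moreover have "\<bar>(B - F1 m) * (x - m)\<bar> \<le> 5 * K\<^sup>2 * \<tau> * \<tau>"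
    unfolding abs_mult B_def m_def d_def d'_def
    using assms(1-4) xm by (intro mult_mono slope_error) (auto simp: m_def)
  then have "\<bar>B * (x - m) - F1 m * (x - m)\<bar> \<le> 5 * K\<^sup>2 * \<tau>\<^sup>2"
    by (simp add: left_diff_distrib power2_eq_square)
  ultimately show ?thesis unfolding B_def[symmetric] by linarith
qed

section \<open>Summation over the cells\<close>

text \<open>The kernel masses of the cells telescope, so the total error is the pointwise bound
  times the mass of \<open>{0..t}\<close>, without a factor counting cells.\<close>

lemma quadrature_error:
  fixes \<alpha> \<sigma> \<tau> :: real and j :: nat
  assumes \<alpha>: "0 < \<alpha>" "\<alpha> < 1" and \<sigma>: "\<sigma> = 1 - \<alpha> / 2" and \<tau>: "0 < \<tau>"
    and t_def: "t = (real j + \<sigma>) * \<tau>" and b_def: "b = (real j + 1) * \<tau>"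
  shows "\<bar>integral {0..t} (\<lambda>x. (t - x) powr (-\<alpha>) * F x)
      - \<tau> powr (1 - \<alpha>) / (1 - \<alpha>) * (\<Sum>s=0..j. coeff_c \<alpha> \<sigma> \<tau> lam j (j - s) * fwd_diff \<tau> v s)\<bar>
     \<le> 10 * K\<^sup>2 * \<tau>\<^sup>2 * (t powr (1 - \<alpha>) / (1 - \<alpha>))"
proof -
  define D where "D = 10 * K\<^sup>2 * \<tau>\<^sup>2"
  define w where "w x = (t - x) powr (-\<alpha>) * F x" for x
  define E where "E x = (t - x) powr (1 - \<alpha>)" for x
  define d where "d = fwd_diff \<tau> v"
  define R where "R = \<tau> powr (1 - \<alpha>) / (1 - \<alpha>)"
  \<comment> \<open>The summand of the regrouped discrete sum; the integral over cell
    \<open>k\<close> is to be compared with \<open>R * P k\<close>.\<close>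
  define P where "P k = lam ((real (j - k) + \<sigma> - 1/2) * \<tau>) * coeff_a \<alpha> \<sigma> (j - k) * d k
       + coeff_b \<alpha> \<sigma> (j - k) * (lam ((real (j - Suc k) + \<sigma>) * \<tau>) * d (Suc k)
           - lam ((real (j - k) + \<sigma>) * \<tau>) * d k)" for k
  have d: "d k = (v (real k * \<tau> + \<tau>) - v (real k * \<tau>)) / \<tau>" for k
    by (simp add: d_def fwd_diff_def algebra_simps)
  have \<sigma>': "1/2 < \<sigma>" "\<sigma> < 1" using \<alpha> \<sigma> by auto
  have w: "w integrable_on {0..t}"
    unfolding w_def using \<alpha> t F_continuous by (intro integrable_weight_mult_continuous)
  have cell: "\<bar>integral {real k * \<tau>..real (Suc k) * \<tau>} w - R * P k\<bar>
      \<le> D * ((E (real k * \<tau>) - E (real (Suc k) * \<tau>)) / (1 - \<alpha>))" if "k < j" for k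
  proof -
    \<comment> \<open>\<open>l\<close> full cells separate cell \<open>k\<close> from the truncated
      one, so its coefficients have index \<open>Suc l = j - k\<close>.\<close>
    define l where "l = j - Suc k"
    have j: "real j = real l + 1 + real k" "j - k = Suc l" using that by (auto simp: l_def)
    define p where "p = real k * \<tau>"
    define B where "B = (lam (t - (p + \<tau>)) * d (Suc k) - lam (t - p) * d k) / \<tau>"
    have p: "real (Suc k) * \<tau> = p + \<tau>" "p + \<tau> + \<tau> = p + 2 * \<tau>"
      by (auto simp: p_def algebra_simps)
    have tp: "t - p = (real (Suc l) + \<sigma>) * \<tau>" "t - (p + \<tau>) = (real l + \<sigma>) * \<tau>"
      "t - (p + \<tau> / 2) = (real (Suc l) + \<sigma> - 1/2) * \<tau>"
      unfolding t_def p_def j by (auto simp: algebra_simps)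
    have le: "0 \<le> p" "p + \<tau> \<le> t" "p + 2 * \<tau> \<le> b"
    proof -
      show "0 \<le> p" using \<tau> by (simp add: p_def)
      have "0 \<le> t - (p + \<tau>)" unfolding tp using \<tau> \<sigma>' by simp
      then show "p + \<tau> \<le> t" by simp
      have "b - (p + 2 * \<tau>) = real l * \<tau>" unfolding b_def p_def j by (simp add: algebra_simps)
      also have "\<dots> \<ge> 0" using \<tau> by simp
      finally show "p + 2 * \<tau> \<le> b" by simp
    qed
    have err: "\<bar>F x - (lam (t - (p + \<tau> / 2)) * d k + B * (x - (p + \<tau> / 2)))\<bar> \<le> D"
      if "x \<in> {p..p + \<tau>}" for x
      unfolding B_def D_def d p p_def[symmetric]
      using interior_cell_error[OF \<tau> le that] .
    have "\<bar>integral {p..p + \<tau>} w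
        - (lam (t - (p + \<tau> / 2)) * d k * ((E p - E (p + \<tau>)) / (1 - \<alpha>))
           + B * ((t - (p + \<tau> / 2)) * ((E p - E (p + \<tau>)) / (1 - \<alpha>))
           - ((t - p) powr (2 - \<alpha>) - (t - (p + \<tau>)) powr (2 - \<alpha>)) / (2 - \<alpha>)))\<bar>
        \<le> D * ((E p - E (p + \<tau>)) / (1 - \<alpha>))"
      unfolding w_def E_def using \<alpha> \<tau> le F_continuous err by (intro weighted_integral_error) auto
    moreover have "(E p - E (p + \<tau>)) / (1 - \<alpha>) = R * coeff_a \<alpha> \<sigma> (Suc l)"
      unfolding E_def tp R_def using \<alpha> \<tau> \<sigma>' by (intro powr_weights_scaled(1)) auto
    moreover have "(t - (p + \<tau> / 2)) * ((E p - E (p + \<tau>)) / (1 - \<alpha>))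
           - ((t - p) powr (2 - \<alpha>) - (t - (p + \<tau>)) powr (2 - \<alpha>)) / (2 - \<alpha>)
           = \<tau> * (R * coeff_b \<alpha> \<sigma> (Suc l))"
      unfolding E_def tp R_def using \<alpha> \<tau> \<sigma>' by (intro powr_weights_scaled(2)) auto
    \<comment> \<open>The factor \<open>\<tau>\<close> of the moment cancels the denominator of the
      slope.\<close>
    moreover have B: "B * (\<tau> * y) = (lam (t - (p + \<tau>)) * d (Suc k) - lam (t - p) * d k) * y" for y
      unfolding B_def using \<tau> by simp
    have "lam (t - (p + \<tau> / 2)) * d k * (R * coeff_a \<alpha> \<sigma> (Suc l))
        + B * (\<tau> * (R * coeff_b \<alpha> \<sigma> (Suc l))) = R * P k"
      unfolding B P_def j l_def[symmetric] tp
      by (simp add: algebra_simps)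
    ultimately show ?thesis unfolding p p_def[symmetric] by simp
  qed
  have partial: "\<bar>integral {0..real n * \<tau>} w - R * (\<Sum>k<n. P k)\<bar> \<le> D * ((E 0 - E (real n * \<tau>)) / (1 - \<alpha>))"
    if "n \<le> j" for n
    using that
  proof (induction n)
    case (Suc n)
    have "real (Suc n) * \<tau> \<le> real j * \<tau>" using Suc.prems \<tau> by (intro mult_right_mono) auto
    also have "\<dots> \<le> t" using \<tau> \<sigma>' by (simp add: t_def)
    finally have int: "w integrable_on {0..real (Suc n) * \<tau>}"
      using \<tau> by (intro integrable_subinterval_real[OF w]) auto
    have "integral {0..real n * \<tau>} w + integral {real n * \<tau>..real (Suc n) * \<tau>} w
        = integral {0..real (Suc n) * \<tau>} w"
      by (rule Henstock_Kurzweil_Integration.integral_combine[OF _ _ int]) (use \<tau> in auto)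
    moreover have "\<bar>integral {0..real n * \<tau>} w - R * (\<Sum>k<n. P k)\<bar>
        \<le> D * ((E 0 - E (real n * \<tau>)) / (1 - \<alpha>))"
      using Suc by simp
    moreover have "\<bar>integral {real n * \<tau>..real (Suc n) * \<tau>} w - R * P n\<bar>
        \<le> D * ((E (real n * \<tau>) - E (real (Suc n) * \<tau>)) / (1 - \<alpha>))"
      using cell Suc.prems by simp
    moreover have "D * ((E 0 - E (real (Suc n) * \<tau>)) / (1 - \<alpha>))
      = D * ((E 0 - E (real n * \<tau>)) / (1 - \<alpha>)) + D * ((E (real n * \<tau>) - E (real (Suc n) * \<tau>)) / (1 - \<alpha>))"
      by (simp add: diff_divide_distrib algebra_simps)
    moreover have "R * (\<Sum>k<Suc n. P k) = R * (\<Sum>k<n. P k) + R * P n"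
      by (simp add: algebra_simps)
    ultimately show ?case by linarith
  qed simp
  define p where "p = real j * \<tau>"
  have p: "0 \<le> p" "p + \<tau> \<le> b" "p + \<tau> / 2 \<le> t" "t \<le> p + \<tau>" "p \<le> t"
    and tp: "t - p = \<sigma> * \<tau>" "t - (p + \<tau> / 2) = (\<sigma> - 1/2) * \<tau>"
    using \<tau> \<sigma>' by (auto simp: p_def t_def b_def algebra_simps)
  have last: "\<bar>integral {p..t} w
        - (lam (t - (p + \<tau> / 2)) * d j * ((E p - E t) / (1 - \<alpha>))
           + F1 (p + \<tau> / 2) * ((t - (p + \<tau> / 2)) * ((E p - E t) / (1 - \<alpha>))
           - ((t - p) powr (2 - \<alpha>) - (t - t) powr (2 - \<alpha>)) / (2 - \<alpha>)))\<bar>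
        \<le> D * ((E p - E t) / (1 - \<alpha>))"
    unfolding w_def E_def d p_def[symmetric] D_def using \<alpha> \<tau> p F_continuous
    by (intro weighted_integral_error last_cell_error) auto
  have Et: "E t = 0" by (simp add: E_def)
  \<comment> \<open>Up to \<open>R\<close>, \<open>coeff_a\<close> at 0 is the kernel mass of the
    truncated cell.\<close>
  have Ep: "(E p - E t) / (1 - \<alpha>) = R * coeff_a \<alpha> \<sigma> 0"
    unfolding Et E_def tp R_def using \<tau> \<sigma>' by (simp add: coeff_a_def powr_mult)
  have pow: "(t - p) powr (2 - \<alpha>) = \<sigma> * \<tau> * E p"
    using powr_add[of "\<sigma> * \<tau>" 1 "1 - \<alpha>"] \<tau> \<sigma>' unfolding E_def tp by simp
  have half: "(\<sigma> - 1/2) / (1 - \<alpha>) = 1/2" "\<sigma> / (2 - \<alpha>) = 1/2"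
    unfolding \<sigma> using \<alpha> by (auto simp: field_simps)
  \<comment> \<open>the choice \<open>\<sigma> = 1 - \<alpha> / 2\<close> makes the first weighted moment of the last cell vanish,
    so the scheme needs no slope term there\<close>
  have moment: "(t - (p + \<tau> / 2)) * ((E p - E t) / (1 - \<alpha>))
           - ((t - p) powr (2 - \<alpha>) - (t - t) powr (2 - \<alpha>)) / (2 - \<alpha>) = 0"
  proof -
    have "(\<sigma> - 1/2) * \<tau> * (E p / (1 - \<alpha>)) - \<sigma> * \<tau> * E p / (2 - \<alpha>)
        = ((\<sigma> - 1/2) / (1 - \<alpha>) - \<sigma> / (2 - \<alpha>)) * (\<tau> * E p)"
      by (simp add: algebra_simps diff_divide_distrib)
    then show ?thesis unfolding half tp(2) Et pow by simp
  qed
  have lastP: "\<bar>integral {p..t} w - R * (lam ((\<sigma> - 1/2) * \<tau>) * coeff_a \<alpha> \<sigma> 0 * d j)\<bar>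
      \<le> D * ((E p - E t) / (1 - \<alpha>))"
    using last[unfolded moment] unfolding Ep tp(2) by (simp add: algebra_simps)
  have "integral {0..p} w + integral {p..t} w = integral {0..t} w"
    using p w by (intro Henstock_Kurzweil_Integration.integral_combine) auto
  moreover have "D * ((E 0 - E p) / (1 - \<alpha>)) + D * ((E p - E t) / (1 - \<alpha>)) = D * (E 0 / (1 - \<alpha>))"
    unfolding Et by (simp add: diff_divide_distrib algebra_simps)
  moreover have "R * (\<Sum>s=0..j. coeff_c \<alpha> \<sigma> \<tau> lam j (j - s) * d s)
     = R * (\<Sum>k<j. P k) + R * (lam ((\<sigma> - 1/2) * \<tau>) * coeff_a \<alpha> \<sigma> 0 * d j)"
    unfolding sum_coeff_c_regroup P_def by (rule distrib_left)
  moreover have "\<bar>integral {0..p} w - R * (\<Sum>k<j. P k)\<bar> \<le> D * ((E 0 - E p) / (1 - \<alpha>))"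
    using partial[of j] by (simp add: p_def)
  ultimately have "\<bar>integral {0..t} w - R * (\<Sum>s=0..j. coeff_c \<alpha> \<sigma> \<tau> lam j (j - s) * d s)\<bar>
      \<le> D * (E 0 / (1 - \<alpha>))"
    using lastP by linarith
  then show ?thesis unfolding w_def R_def d_def D_def E_def by simp
qed

end

section \<open>From smoothness classes to the truncation error\<close>

text \<open>\<open>nderiv_on (Suc i)\<close> is \<open>deriv_on\<close> of
  \<open>nderiv_on i\<close>, and differentiability makes the chosen
  \<open>vector_derivative\<close> a genuine derivative.\<close>

lemma C_k_on_has_real_derivative:
  assumes "C_k_on k S f" "i < k" "x \<in> S"
  shows "(nderiv_on i S f has_real_derivative nderiv_on (Suc i) S f x) (at x within S)"
proof -
  have "nderiv_on i S f differentiable (at x within S)"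
    using assms by (auto simp: C_k_on_def differentiable_on_def)
  then show ?thesis
    by (simp add: has_real_derivative_iff_has_vector_derivative nderiv_on_def deriv_on_def
        vector_derivative_works)
qed

text \<open>The constant of the error term is chosen before the grid, the interval and the
  functions. As \<open>I\<close> changes with the grid, one fixed \<open>K\<close> expresses the
  bounds on the data.\<close>

theorem lemma3p1:
  fixes \<alpha> \<sigma> T K :: real
  assumes "0 < \<alpha>" and "\<alpha> < 1" and "\<sigma> = 1 - \<alpha> / 2" and "0 < T"
  shows "\<exists>C. \<forall>(M::nat) (j::nat) (\<tau>::real) (lam :: real \<Rightarrow> real) (v :: real \<Rightarrow> real) (I :: real set).
      1 \<le> M \<longrightarrow> j < M \<longrightarrow> \<tau> = T / real M \<longrightarrow> I = {0..real (j + 1) * \<tau>} \<longrightarrow>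
      C_k_on 2 I lam \<longrightarrow> (\<forall>t\<in>I. lam t > 0) \<longrightarrow> (\<forall>t\<in>I. deriv_on I lam t \<le> 0) \<longrightarrow>
      C_k_on 3 I v \<longrightarrow>
      (\<forall>i\<le>2. \<forall>t\<in>I. \<bar>nderiv_on i I lam t\<bar> \<le> K) \<longrightarrow>
      (\<forall>i\<le>3. \<forall>t\<in>I. \<bar>nderiv_on i I v t\<bar> \<le> K) \<longrightarrow>
      \<bar>caputo_deriv \<alpha> lam ((real j + \<sigma>) * \<tau>) v - discrete_caputo \<alpha> \<sigma> \<tau> lam j v\<bar> \<le> C * \<tau>\<^sup>2"
proof (intro exI allI impI)
  fix M j :: nat and \<tau> :: real and lam v :: "real \<Rightarrow> real" and I :: "real set"
  assume M: "1 \<le> M" "j < M" and \<tau>: "\<tau> = T / real M" and I: "I = {0..real (j + 1) * \<tau>}"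
    and lam: "C_k_on 2 I lam" and v: "C_k_on 3 I v"
    and lam_bd: "\<forall>i\<le>2. \<forall>t\<in>I. \<bar>nderiv_on i I lam t\<bar> \<le> K"
    and v_bd: "\<forall>i\<le>3. \<forall>t\<in>I. \<bar>nderiv_on i I v t\<bar> \<le> K"
  define t where "t = (real j + \<sigma>) * \<tau>"
  define b where "b = (real j + 1) * \<tau>"
  define G where "G = Gamma (1 - \<alpha>)"
  have I': "I = {0..b}" unfolding I b_def by (simp add: add.commute)
  have \<tau>0: "0 < \<tau>" using assms M \<tau> by simp
  have \<sigma>': "0 < \<sigma>" "\<sigma> < 1" using assms by auto
  have t: "0 \<le> t" "t \<le> b" using \<tau>0 \<sigma>' by (auto simp: t_def b_def mult_right_mono)
  have id: "nderiv_on 0 I f = f" for f by (simp add: nderiv_on_def)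
  have lamD: "x \<in> {0..b} \<Longrightarrow> (nderiv_on i I lam has_real_derivative nderiv_on (Suc i) I lam x) (at x within {0..b})"
    if "i < 2" for i x
    using C_k_on_has_real_derivative[OF lam that] by (simp add: I')
  have vD: "x \<in> {0..b} \<Longrightarrow> (nderiv_on i I v has_real_derivative nderiv_on (Suc i) I v x) (at x within {0..b})"
    if "i < 3" for i x
    using C_k_on_has_real_derivative[OF v that] by (simp add: I')
  interpret smooth_caputo_data b t K lam "nderiv_on 1 I lam" "nderiv_on 2 I lam"
    v "nderiv_on 1 I v" "nderiv_on 2 I v" "nderiv_on 3 I v"
  proof
    fix x assume x: "x \<in> {0..b}"
    show "(lam has_real_derivative nderiv_on 1 I lam x) (at x within {0..b})"
      "(nderiv_on 1 I lam has_real_derivative nderiv_on 2 I lam x) (at x within {0..b})"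
      "(v has_real_derivative nderiv_on 1 I v x) (at x within {0..b})"
      "(nderiv_on 1 I v has_real_derivative nderiv_on 2 I v x) (at x within {0..b})"
      "(nderiv_on 2 I v has_real_derivative nderiv_on 3 I v x) (at x within {0..b})"
      using lamD[of 0, OF _ x] lamD[of 1, OF _ x] vD[of 0, OF _ x] vD[of 1, OF _ x] vD[of 2, OF _ x]
      by (simp_all add: id eval_nat_numeral)
    have "x \<in> I" using x I' by simp
    then show "\<bar>lam x\<bar> \<le> K" "\<bar>nderiv_on 1 I lam x\<bar> \<le> K" "\<bar>nderiv_on 2 I lam x\<bar> \<le> K"
      "\<bar>nderiv_on 1 I v x\<bar> \<le> K" "\<bar>nderiv_on 2 I v x\<bar> \<le> K" "\<bar>nderiv_on 3 I v x\<bar> \<le> K"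
      using lam_bd[rule_format, of 0 x] lam_bd[rule_format, of 1 x] lam_bd[rule_format, of 2 x]
        v_bd[rule_format, of 1 x] v_bd[rule_format, of 2 x] v_bd[rule_format, of 3 x]
      by (simp_all add: id)
  qed (use t in auto)
  have "deriv v x = nderiv_on 1 I v x" if "x \<in> {0<..<t}" for x
  proof -
    have "x \<in> interior {0..b}" using that t by simp
    then have "(v has_real_derivative nderiv_on 1 I v x) (at x)"
      using vD[of 0 x] that t at_within_interior[of x "{0..b}"] by (simp add: id)
    then show ?thesis by (rule DERIV_imp_deriv)
  qed
  \<comment> \<open>Spiking at the null set \<open>{0, t}\<close> discards the endpoints; at 0 the
    two-sided \<open>deriv v\<close> may be unspecified.\<close>
  then have "integral {0..t} (\<lambda>x. lam (t - x) / (t - x) powr \<alpha> * deriv v x)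
      = integral {0..t} (\<lambda>x. (t - x) powr (-\<alpha>) * F x)"
    by (intro integral_spike[of "{0, t}"]) (auto simp: F_def powr_minus divide_inverse simp del: One_nat_def)
  then have caputo: "caputo_deriv \<alpha> lam t v = integral {0..t} (\<lambda>x. (t - x) powr (-\<alpha>) * F x) / G"
    by (simp add: caputo_deriv_def G_def)
  have G: "0 < G" using assms by (simp add: G_def Gamma_real_pos)
  \<comment> \<open>The functional equation hands the factor \<open>1 - \<alpha>\<close> to the
    quadrature weights and leaves \<open>G\<close> as common denominator.\<close>
  have "Gamma (2 - \<alpha>) = (1 - \<alpha>) * G"
    using Gamma_plus1[of "1 - \<alpha>"] nonpos_Ints_nonpos[of "1 - \<alpha>"] assms
    by (auto simp: G_def)
  then have discrete: "discrete_caputo \<alpha> \<sigma> \<tau> lam j v = \<tau> powr (1 - \<alpha>) / (1 - \<alpha>)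
      * (\<Sum>s=0..j. coeff_c \<alpha> \<sigma> \<tau> lam j (j - s) * fwd_diff \<tau> v s) / G"
    by (simp add: discrete_caputo_def)
  have "\<bar>caputo_deriv \<alpha> lam t v - discrete_caputo \<alpha> \<sigma> \<tau> lam j v\<bar>
      = \<bar>integral {0..t} (\<lambda>x. (t - x) powr (-\<alpha>) * F x) - \<tau> powr (1 - \<alpha>) / (1 - \<alpha>)
      * (\<Sum>s=0..j. coeff_c \<alpha> \<sigma> \<tau> lam j (j - s) * fwd_diff \<tau> v s)\<bar> / G"
    unfolding caputo discrete diff_divide_distrib[symmetric] abs_divide using G by simp
  also have "\<dots> \<le> 10 * K\<^sup>2 * \<tau>\<^sup>2 * (t powr (1 - \<alpha>) / (1 - \<alpha>)) / G"
    using quadrature_error[OF assms(1-3) \<tau>0 t_def b_def] G by (intro divide_right_mono) auto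
  \<comment> \<open>Because \<open>t \<le> b \<le> M * \<tau> = T\<close>, replacing
    \<open>t\<close> by \<open>T\<close> frees the constant from \<open>j\<close> and
    \<open>M\<close>.\<close>
  also have "\<dots> \<le> 10 * K\<^sup>2 * \<tau>\<^sup>2 * (T powr (1 - \<alpha>) / (1 - \<alpha>)) / G"
  proof -
    have "b \<le> real M * \<tau>" unfolding b_def using M \<tau>0 by (intro mult_right_mono) auto
    also have "\<dots> = T" using M \<tau> by simp
    finally have "t \<le> T" using t by simp
    then have "t powr (1 - \<alpha>) \<le> T powr (1 - \<alpha>)"
      using t assms by (intro powr_mono2) auto
    then show ?thesis
      using assms G by (intro divide_right_mono mult_left_mono) auto
  qed
  also have "\<dots> = 10 * K\<^sup>2 * T powr (1 - \<alpha>) / ((1 - \<alpha>) * Gamma (1 - \<alpha>)) * \<tau>\<^sup>2"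
    by (simp add: G_def)
  finally show "\<bar>caputo_deriv \<alpha> lam ((real j + \<sigma>) * \<tau>) v - discrete_caputo \<alpha> \<sigma> \<tau> lam j v\<bar>
      \<le> 10 * K\<^sup>2 * T powr (1 - \<alpha>) / ((1 - \<alpha>) * Gamma (1 - \<alpha>)) * \<tau>\<^sup>2"
    by (simp add: t_def)
qed

end
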